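(* Let $N\ge 3$ be an integer. The minimum number of transmit--listen rounds $R\in\mathbb N$ for which there exists a bidirectionally feasible schedule $\bm X\in\{0,1\}^{R\times(N-1)}$ for an $N$-node network (with no restriction on the number of simultaneous transmitters in a round) is $$R^\star_\infty=\min\left\{R\in\mathbb N:\binom{R}{\lfloor R/2\rfloor}\ge N-1\right\}.$$
   Context: $\mathbb N$ is the set of positive integers and $[R]=\{1,\dots,R\}$. The nodes are $\mathcal N=\{1,\dots,N\}$; node $1$ is the reference node and nodes $2,\dots,N$ are the non-reference nodes. A schedule with $R$ rounds is a binary matrix $\bm X=[\bm\chi_2,\dots,\bm\chi_N]\in\{0,1\}^{R\times(N-1)}$ whose columns are codewords $\bm\chi_n=[\chi_{n,1},\dots,\chi_{n,R}]^{\mathrm T}$; $\chi_{n,r}=1$ means node $n$ transmits in round $r$, and $\chi_{n,r}=0$ means it listens. For distinct $n_1,n_2\in\{2,\dots,N\}$ put $\Gamma_{n_1\to n_2}(\bm X)=\sum_{r=1}^R\chi_{n_1,r}(1-\chi_{n_2,r})$. The schedule $\bm X$ is bidirectionally feasible if $\Gamma_{n_1\to n_2}(\bm X)\ge 1$ for all ordered pairs of distinct $n_1,n_2\in\{2,\dots,N\}$. *)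

theory Defs
  imports Complex_Main
begin

text \<open>
  A matrix with rows \<open>1, \<dots>, R\<close> (rounds) and columns \<open>2, \<dots>, N\<close> (non-reference nodes) is a
  function \<open>X\<close> whose entry \<open>X r n\<close> is the \<open>r\<close>-th symbol of the codeword of node \<open>n\<close>
  (1 for transmit, 0 for listen); values outside these index ranges are irrelevant.
\<close>

definition schedule :: "nat \<Rightarrow> nat \<Rightarrow> (nat \<Rightarrow> nat \<Rightarrow> int) \<Rightarrow> bool" where
  "schedule R N X \<longleftrightarrow> (\<forall>r\<in>{1..R}. \<forall>n\<in>{2..N}. X r n \<in> {0, 1})"

definition Gam :: "nat \<Rightarrow> (nat \<Rightarrow> nat \<Rightarrow> int) \<Rightarrow> nat \<Rightarrow> nat \<Rightarrow> int" where
  "Gam R X n1 n2 = (\<Sum>r = 1..R. X r n1 * (1 - X r n2))"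

definition bidirectionally_feasible :: "nat \<Rightarrow> nat \<Rightarrow> (nat \<Rightarrow> nat \<Rightarrow> int) \<Rightarrow> bool" where
  "bidirectionally_feasible R N X \<longleftrightarrow>
     (\<forall>n1\<in>{2..N}. \<forall>n2\<in>{2..N}. n1 \<noteq> n2 \<longrightarrow> Gam R X n1 n2 \<ge> 1)"

definition has_feasible_schedule :: "nat \<Rightarrow> nat \<Rightarrow> bool" where
  "has_feasible_schedule N R \<longleftrightarrow> (\<exists>X. schedule R N X \<and> bidirectionally_feasible R N X)"

end

theory Submission
  imports Defs "HOL-Combinatorics.Multiset_Permutations"
begin

text \<open>
  A schedule is bidirectionally feasible iff the sets of rounds in which the non-reference nodes
  transmit form an antichain of \<open>N - 1\<close> distinct subsets of \<open>{1..R}\<close>, so the claim is Sperner's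
  theorem, proved here by Lubell's double counting. A permutation of the ground set, read as a list,
  is a maximal chain of subsets, namely the sets of its prefixes. A set \<open>A\<close> occurs in exactly
  \<open>|A|! (n - |A|)!\<close> of these chains, and no chain meets an antichain twice.
\<close>

lemma sum_fact_antichain_le:
  assumes S: "finite S" and F: "F \<subseteq> Pow S"
    and antichain: "\<And>A B. A \<in> F \<Longrightarrow> B \<in> F \<Longrightarrow> A \<subseteq> B \<Longrightarrow> A = B"
  shows "(\<Sum>A\<in>F. fact (card A) * fact (card S - card A)) \<le> (fact (card S) :: nat)"
proof -
  \<comment> \<open>\<open>C A\<close> collects the maximal chains through \<open>A\<close>: the
    orderings of \<open>S\<close> that list \<open>A\<close> first and its complement
    afterwards.\<close>
  define C where
    "C A = (\<lambda>(xs, ys). xs @ ys) ` (permutations_of_set A \<times> permutations_of_set (S - A))" for A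
  have fin: "finite A" if "A \<in> F" for A
    using that F S by (meson PowD finite_subset subsetD)
  have card_C: "card (C A) = fact (card A) * fact (card S - card A)" if "A \<in> F" for A
  proof -
    \<comment> \<open>All first components have length \<open>card A\<close>, so the concatenation
      determines where to cut.\<close>
    have "inj_on (\<lambda>(xs, ys). xs @ ys) (permutations_of_set A \<times> permutations_of_set (S - A))"
      by (auto intro!: inj_onI simp: length_finite_permutations_of_set)
    moreover have "card (S - A) = card S - card A"
      using that F fin by (intro card_Diff_subset) auto
    ultimately show ?thesis
      using that fin S by (simp add: C_def card_image card_cartesian_product)
  qed
  have disjoint: "C A \<inter> C B = {}" if AB: "A \<in> F" "B \<in> F" "A \<noteq> B" for A B
  proof (rule ccontr)
    assume "C A \<inter> C B \<noteq> {}"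
    then obtain xs ys xs' ys' where eq: "xs @ ys = xs' @ ys'"
      and "xs \<in> permutations_of_set A" "xs' \<in> permutations_of_set B"
      by (auto simp: C_def)
    then have "set xs = A" "set xs' = B"
      by (auto simp: permutations_of_set_def)
    \<comment> \<open>Two prefixes of the same list are comparable, hence so are their sets.\<close>
    with eq have "A \<subseteq> B \<or> B \<subseteq> A"
      by (auto simp: append_eq_append_conv2)
    with AB antichain show False by blast
  qed
  have sub: "C A \<subseteq> permutations_of_set S" if "A \<in> F" for A
  proof -
    have "A \<subseteq> S"
      using that F by auto
    then show ?thesis
      by (auto simp: C_def permutations_of_set_def)
  qed
  have "(\<Sum>A\<in>F. fact (card A) * fact (card S - card A)) = (\<Sum>A\<in>F. card (C A))"
    by (simp add: card_C)
  also have "\<dots> = card (\<Union>A\<in>F. C A)"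
  proof (rule card_UN_disjoint [symmetric])
    show "finite F"
      using F S by (meson finite_Pow_iff finite_subset)
    show "\<forall>A\<in>F. finite (C A)"
      using sub by (meson finite_permutations_of_set finite_subset)
  qed (use disjoint in blast)
  also have "\<dots> \<le> card (permutations_of_set S)"
    using sub by (intro card_mono) auto
  finally show ?thesis
    using S by simp
qed

text \<open>The middle binomial coefficient is the largest in its row, so each member of
  \<open>F\<close> lies on at least a fraction \<open>1 / ?m\<close> of all \<open>fact ?n\<close>
  chains. Multiplying through by \<open>?m\<close> keeps the count in the natural numbers.\<close>

theorem sperner:
  assumes S: "finite S" and F: "F \<subseteq> Pow S"
    and antichain: "\<And>A B. A \<in> F \<Longrightarrow> B \<in> F \<Longrightarrow> A \<subseteq> B \<Longrightarrow> A = B"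
  shows "card F \<le> card S choose (card S div 2)"
proof -
  let ?n = "card S"
  let ?m = "?n choose (?n div 2)"
  have "fact ?n \<le> ?m * (fact (card A) * fact (?n - card A))" if "A \<in> F" for A
  proof -
    have "card A \<le> ?n"
      using that F S by (auto intro: card_mono)
    then have "fact ?n = (?n choose card A) * (fact (card A) * fact (?n - card A))"
      using binomial_fact_lemma [of "card A" ?n] by (simp add: mult.commute)
    then show ?thesis
      by (simp add: binomial_maximum)
  qed
  then have "card F * fact ?n \<le> (\<Sum>A\<in>F. ?m * (fact (card A) * fact (?n - card A)))"
    using sum_bounded_below [of F "fact ?n :: nat"] by simp
  also have "\<dots> \<le> ?m * fact ?n"
    using sum_fact_antichain_le [OF assms]
    unfolding sum_distrib_left [symmetric] by (intro mult_left_mono) auto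
  finally show ?thesis
    by simp
qed

lemma Gam_eq_card:
  assumes "schedule R N X" "n1 \<in> {2..N}" "n2 \<in> {2..N}"
  shows "Gam R X n1 n2 = int (card ({r\<in>{1..R}. X r n1 = 1} - {r\<in>{1..R}. X r n2 = 1}))"
proof -
  have "Gam R X n1 n2 = (\<Sum>r\<in>{1..R}. if X r n1 = 1 \<and> X r n2 \<noteq> 1 then 1 else 0)"
    unfolding Gam_def using assms by (intro sum.cong) (fastforce simp: schedule_def)+
  also have "\<dots> = int (card {r\<in>{1..R}. X r n1 = 1 \<and> X r n2 \<noteq> 1})"
    by (simp add: sum.If_cases Int_def)
  also have "{r\<in>{1..R}. X r n1 = 1 \<and> X r n2 \<noteq> 1} =
      {r\<in>{1..R}. X r n1 = 1} - {r\<in>{1..R}. X r n2 = 1}"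
    by auto
  finally show ?thesis .
qed

text \<open>This turns feasibility into non-inclusion of transmit sets: a set difference is nonempty
  exactly when inclusion fails.\<close>

lemma Gam_ge_1_iff:
  assumes "schedule R N X" "n1 \<in> {2..N}" "n2 \<in> {2..N}"
  shows "Gam R X n1 n2 \<ge> 1 \<longleftrightarrow> \<not> {r\<in>{1..R}. X r n1 = 1} \<subseteq> {r\<in>{1..R}. X r n2 = 1}"
proof -
  have "int k \<ge> 1 \<longleftrightarrow> k \<noteq> 0" for k
    by auto
  then show ?thesis
    unfolding Gam_eq_card [OF assms] by (simp only: card_eq_0_iff Diff_eq_empty_iff) simp
qed

text \<open>Sperner's theorem gives the bound, and the middle layer of the subset lattice attains
  it.\<close>

lemma has_feasible_schedule_iff:
  "has_feasible_schedule N R \<longleftrightarrow> N - 1 \<le> R choose (R div 2)"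
proof
  assume "has_feasible_schedule N R"
  then obtain X where X: "schedule R N X" and feas: "bidirectionally_feasible R N X"
    by (auto simp: has_feasible_schedule_def)
  define T where "T n = {r\<in>{1..R}. X r n = 1}" for n
  \<comment> \<open>This yields both that the \<open>T n\<close> are distinct and that they form an
    antichain.\<close>
  have T: "n1 = n2" if "n1 \<in> {2..N}" "n2 \<in> {2..N}" "T n1 \<subseteq> T n2" for n1 n2
    using feas that Gam_ge_1_iff [OF X that(1,2)]
    by (auto simp: bidirectionally_feasible_def T_def)
  then have "inj_on T {2..N}"
    by (intro inj_onI) blast
  then have "N - 1 = card (T ` {2..N})"
    by (simp add: card_image)
  also have "\<dots> \<le> card {1..R} choose (card {1..R} div 2)"
  proof (rule sperner)
    show "T ` {2..N} \<subseteq> Pow {1..R}"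
      by (auto simp: T_def)
    show "A = B" if "A \<in> T ` {2..N}" "B \<in> T ` {2..N}" "A \<subseteq> B" for A B
      using that T by blast
  qed simp
  finally show "N - 1 \<le> R choose (R div 2)"
    by simp
next
  assume le: "N - 1 \<le> R choose (R div 2)"
  let ?M = "{A. A \<subseteq> {1..R} \<and> card A = R div 2}"
  have "card ?M = R choose (R div 2)"
    using n_subsets [of "{1..R}" "R div 2"] by simp
  with le have "card {2..N} \<le> card ?M"
    by simp
  then obtain T where T: "T ` {2..N} \<subseteq> ?M" "inj_on T {2..N}"
    using card_le_inj [of "{2..N}" ?M] by auto
  define X :: "nat \<Rightarrow> nat \<Rightarrow> int" where "X r n = of_bool (r \<in> T n)" for r n
  have X: "schedule R N X"
    by (simp add: schedule_def X_def)
  have "Gam R X n1 n2 \<ge> 1" if n: "n1 \<in> {2..N}" "n2 \<in> {2..N}" "n1 \<noteq> n2" for n1 n2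
  proof -
    have *: "{r\<in>{1..R}. X r n = 1} = T n" if "n \<in> {2..N}" for n
    proof -
      have "T n \<subseteq> {1..R}"
        using that T(1) by blast
      then show ?thesis
        by (auto simp: X_def)
    qed
    have "T n1 \<in> ?M" "T n2 \<in> ?M"
      using n T(1) by blast+
    moreover have "T n1 \<noteq> T n2"
      using n T(2) by (auto dest: inj_onD)
    ultimately have "\<not> T n1 \<subseteq> T n2"
      \<comment> \<open>Both sets have size \<open>R div 2\<close>, so an inclusion would force
        equality.\<close>
      by (metis (mono_tags, lifting) card_subset_eq finite_atLeastAtMost finite_subset mem_Collect_eq)
    then show ?thesis
      using Gam_ge_1_iff [OF X n(1,2)] * n by simp
  qed
  then show "has_feasible_schedule N R"
    using X by (auto simp: has_feasible_schedule_def bidirectionally_feasible_def)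
qed

theorem theorem1:
  fixes N :: nat
  assumes "N \<ge> 3"
  shows "(\<exists>R\<ge>1. has_feasible_schedule N R) \<and>
         (\<exists>R\<ge>1. R choose (R div 2) \<ge> N - 1) \<and>
         (LEAST R. R \<ge> 1 \<and> has_feasible_schedule N R) =
         (LEAST R. R \<ge> 1 \<and> R choose (R div 2) \<ge> N - 1)"
proof -
  \<comment> \<open>The witness \<open>R = N - 1\<close> shows that both minima exist:
    \<open>N - 1\<close> is \<open>(N - 1) choose 1\<close>, at most the middle coefficient. The
    equivalence for each \<open>R\<close> then makes the minima equal.\<close>
  have "N - 1 \<le> (N - 1) choose ((N - 1) div 2)"
    using binomial_maximum [of "N - 1" 1] by simp
  moreover have "N - 1 \<ge> 1"
    using assms by simp
  ultimately show ?thesis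
    unfolding has_feasible_schedule_iff by blast
qed

end
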